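(* Let $S$ be a subsemigroup of $((0,\infty),+)$ which is dense in $(0,\infty)$, let $\mathcal F$ be a class of finite image partition regular matrices with entries from $\mathbb Q$, and let $B$ be a matrix which is image partition regular near zero over $S$. Then $I(B;S)\cap\bigcap_{A\in\mathcal F} I(A;S)\neq\emptyset$.
   Context: Matrices have rows and columns indexed by countable ordinals (finite means $u\times v$ with $u,v\in\mathbb N$). A matrix is admissible if its entries are rational, it has no zero row, and each row has finitely many nonzero entries. An admissible $\alpha\times\delta$ matrix is image partition regular if whenever $\mathbb N$ is finitely colored there is $\vec x\in\mathbb N^\delta$ with all entries of $A\vec x$ of the same color. An admissible $\alpha\times\delta$ matrix $B$ is image partition regular near zero over $S$ if whenever $S$ is finitely colored and $\varepsilon>0$, there is $\vec x\in S^\delta$ such that the entries of $B\vec x$ are monochromatic and lie in $(-\varepsilon,\varepsilon)$. $\beta S$ is the set of ultrafilters on $S$. For an $\alpha\times\delta$ rational matrix $A$, $I(A;S)=\{p\in\beta S:$ for every $P\in p$ there is $\vec x\in S^\delta$ with all entries of $A\vec x$ in $P\}$. *)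

theory Defs
  imports "HOL-Analysis.Analysis"
begin

text \<open>
  A rational \<open>\<alpha> \<times> \<delta>\<close> matrix is given by its two index ordinals and its entries.
  An ordinal is represented, as in \<^theory>\<open>HOL.BNF_Wellorder_Relation\<close>, by a well-order on
  its field; the entries at indices outside the two fields are irrelevant.
\<close>

record ('r, 'c) ord_matrix =
  row_ord :: "'r rel"
  col_ord :: "'c rel"
  entry :: "'r \<Rightarrow> 'c \<Rightarrow> rat"

abbreviation row_index :: "('r, 'c) ord_matrix \<Rightarrow> 'r set" where
  "row_index A \<equiv> Field (row_ord A)"

abbreviation col_index :: "('r, 'c) ord_matrix \<Rightarrow> 'c set" where
  "col_index A \<equiv> Field (col_ord A)"

definition countable_ordinal :: "'a rel \<Rightarrow> bool" where
  "countable_ordinal r \<longleftrightarrow> Well_order r \<and> countable (Field r)"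

definition is_matrix :: "('r, 'c) ord_matrix \<Rightarrow> bool" where
  "is_matrix A \<longleftrightarrow> countable_ordinal (row_ord A) \<and> countable_ordinal (col_ord A)"

definition row_support :: "('r, 'c) ord_matrix \<Rightarrow> 'r \<Rightarrow> 'c set" where
  "row_support A i = {j \<in> col_index A. entry A i j \<noteq> 0}"

definition admissible :: "('r, 'c) ord_matrix \<Rightarrow> bool" where
  "admissible A \<longleftrightarrow> is_matrix A \<and>
     (\<forall>i\<in>row_index A. row_support A i \<noteq> {} \<and> finite (row_support A i))"

text \<open>\<open>natLeq_on u\<close> is the usual order on \<open>{0,\<dots>,u - 1}\<close>, i.e. the finite ordinal \<open>u\<close>.\<close>

definition finite_matrix :: "(nat, nat) ord_matrix \<Rightarrow> bool" where
  "finite_matrix A \<longleftrightarrow>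
     (\<exists>u v. 0 < u \<and> 0 < v \<and> row_ord A = natLeq_on u \<and> col_ord A = natLeq_on v)"

text \<open>
  Entry \<open>i\<close> of \<open>A x\<close>; the sum is over the support of the row, so that it is a finite sum
  for every row-finite matrix, even one with infinitely many columns.
\<close>

definition mat_app :: "('r, 'c) ord_matrix \<Rightarrow> ('c \<Rightarrow> real) \<Rightarrow> 'r \<Rightarrow> real" where
  "mat_app A x i = (\<Sum>j\<in>row_support A i. of_rat (entry A i j) * x j)"

text \<open>The positive integers. Zero is excluded, as otherwise \<open>x = 0\<close> would always work below.\<close>

definition pos_nats :: "real set" where
  "pos_nats = \<nat> - {0}"

text \<open>
  A finite coloring of a set \<open>T\<close> is a map on \<open>T\<close> with finite range; taking the colors in
  \<^typ>\<open>nat\<close> is no restriction.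
\<close>

definition finite_coloring :: "real set \<Rightarrow> (real \<Rightarrow> nat) \<Rightarrow> bool" where
  "finite_coloring T f \<longleftrightarrow> finite (f ` T)"

definition image_partition_regular :: "('r, 'c) ord_matrix \<Rightarrow> bool" where
  "image_partition_regular A \<longleftrightarrow> admissible A \<and>
     (\<forall>f. finite_coloring pos_nats f \<longrightarrow>
       (\<exists>x \<in> col_index A \<rightarrow> pos_nats. \<exists>c. \<forall>i\<in>row_index A.
          mat_app A x i \<in> pos_nats \<and> f (mat_app A x i) = c))"

definition image_partition_regular_near_zero ::
    "real set \<Rightarrow> ('r, 'c) ord_matrix \<Rightarrow> bool" where
  "image_partition_regular_near_zero S B \<longleftrightarrow> admissible B \<and>
     (\<forall>f \<epsilon>. finite_coloring S f \<longrightarrow> 0 < \<epsilon> \<longrightarrow>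
       (\<exists>x \<in> col_index B \<rightarrow> S. \<exists>c. \<forall>i\<in>row_index B.
          mat_app B x i \<in> S \<and> f (mat_app B x i) = c \<and> mat_app B x i \<in> {-\<epsilon><..<\<epsilon>}))"

definition ultrafilter_on :: "'a set \<Rightarrow> 'a set set \<Rightarrow> bool" where
  "ultrafilter_on S p \<longleftrightarrow>
     p \<subseteq> Pow S \<and> S \<in> p \<and> {} \<notin> p \<and>
     (\<forall>P\<in>p. \<forall>Q\<in>p. P \<inter> Q \<in> p) \<and>
     (\<forall>P\<in>p. \<forall>Q. P \<subseteq> Q \<and> Q \<subseteq> S \<longrightarrow> Q \<in> p) \<and>
     (\<forall>P. P \<subseteq> S \<longrightarrow> P \<in> p \<or> S - P \<in> p)"

definition beta :: "'a set \<Rightarrow> 'a set set set" where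
  "beta S = {p. ultrafilter_on S p}"

definition I_set :: "('r, 'c) ord_matrix \<Rightarrow> real set \<Rightarrow> real set set set" where
  "I_set A S = {p \<in> beta S.
     \<forall>P\<in>p. \<exists>x \<in> col_index A \<rightarrow> S. \<forall>i\<in>row_index A. mat_app A x i \<in> P}"

definition dense_subsemigroup :: "real set \<Rightarrow> bool" where
  "dense_subsemigroup S \<longleftrightarrow>
     S \<subseteq> {0<..} \<and> (\<forall>x\<in>S. \<forall>y\<in>S. x + y \<in> S) \<and> {0<..} \<subseteq> closure S"

end

theory Submission
  imports Defs
begin

text \<open>
  Multiplication by a positive integer \<open>n\<close> maps \<open>S\<close> into \<open>S\<close>. Given an ultrafilter \<open>q\<close> on \<open>S\<close> and
  a finite coloring \<open>f\<close> of \<open>S\<close>, color \<open>n\<close> by the color \<open>c\<close> for which \<open>{s. f (n s) = c}\<close> belongs to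
  \<open>q\<close>. If \<open>A x\<close> is monochromatic for this coloring, then a single \<open>s \<in> S\<close> makes \<open>A (s x)\<close>
  monochromatic for \<open>f\<close>, as \<open>A\<close> has finitely many rows; and for a single entry \<open>n\<close> of \<open>A x\<close>,
  all matrices with images in every member of \<open>q\<close> have images in the same color class, obtained
  through multiplication by \<open>n\<close>. Thus finite image partition regular matrices can be added one
  at a time to \<open>B\<close>, and compactness of the space of ultrafilters does the rest.
\<close>

section \<open>Ultrafilters with prescribed large members\<close>

text \<open>Zorn's lemma gives a maximal intersection-closed family of large sets. Any set whose
  traces on all members are large already belongs to it. If neither \<open>P\<close> nor
  \<open>S - P\<close> did, two members would have small traces on them, and the intersection of
  these members would be large yet a union of two small sets.\<close>

lemma ultrafilter_on_of_partition_regular: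
  assumes large_S: "large S" and not_empty: "\<not> large {}"
    and mono: "\<And>P Q. large P \<Longrightarrow> P \<subseteq> Q \<Longrightarrow> Q \<subseteq> S \<Longrightarrow> large Q"
    and regular: "\<And>P Q. P \<subseteq> S \<Longrightarrow> Q \<subseteq> S \<Longrightarrow> large (P \<union> Q) \<Longrightarrow> large P \<or> large Q"
  shows "\<exists>p. ultrafilter_on S p \<and> (\<forall>P\<in>p. large P)"
proof -
  define fam where
    "fam = {p. p \<subseteq> Pow S \<and> S \<in> p \<and> (\<forall>P\<in>p. \<forall>Q\<in>p. P \<inter> Q \<in> p) \<and> (\<forall>P\<in>p. large P)}"
  have "\<exists>M\<in>fam. \<forall>X\<in>fam. M \<subseteq> X \<longrightarrow> X = M"
  proof (rule subset_Zorn_nonempty)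
    show "fam \<noteq> {}" using large_S by (auto simp: fam_def intro!: exI[of _ "{S}"])
  next
    fix C assume "C \<noteq> {}" and C: "subset.chain fam C"
    then have sub: "C \<subseteq> fam" by (simp add: subset_chain_def)
    have "P \<inter> Q \<in> \<Union>C" if PQ: "P \<in> \<Union>C" "Q \<in> \<Union>C" for P Q
    proof -
      obtain p q where pq: "p \<in> C" "q \<in> C" "P \<in> p" "Q \<in> q" using PQ by blast
      have int: "P' \<inter> Q' \<in> p'" if "p' \<in> C" "P' \<in> p'" "Q' \<in> p'" for p' P' Q'
        using that sub by (auto simp: fam_def)
      from C pq have "p \<subseteq> q \<or> q \<subseteq> p" by (auto simp: subset_chain_def)
      then show ?thesis
      proof
        assume "p \<subseteq> q"
        then have "P \<inter> Q \<in> q" using pq int by blast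
        then show ?thesis using pq by blast
      next
        assume "q \<subseteq> p"
        then have "P \<inter> Q \<in> p" using pq int by blast
        then show ?thesis using pq by blast
      qed
    qed
    moreover have "\<Union>C \<subseteq> Pow S" "\<forall>P\<in>\<Union>C. large P" using sub unfolding fam_def by blast+
    moreover have "S \<in> \<Union>C" using sub \<open>C \<noteq> {}\<close> by (auto simp: fam_def)
    ultimately show "\<Union>C \<in> fam" by (simp add: fam_def)
  qed
  then obtain p where p: "p \<in> fam" and max: "\<And>X. X \<in> fam \<Longrightarrow> p \<subseteq> X \<Longrightarrow> X = p" by blast
  have pS: "p \<subseteq> Pow S" "S \<in> p" and int: "\<And>P Q. P \<in> p \<Longrightarrow> Q \<in> p \<Longrightarrow> P \<inter> Q \<in> p"
    and large: "\<And>P. P \<in> p \<Longrightarrow> large P" using p by (auto simp: fam_def)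
  have memI: "P \<in> p" if "P \<subseteq> S" and P: "\<And>Q. Q \<in> p \<Longrightarrow> large (Q \<inter> P)" for P
  proof -
    \<comment> \<open>This is the filter on \<open>S\<close> generated by \<open>p\<close> and
      \<open>P\<close>; it has only large members, so by maximality it equals
      \<open>p\<close>.\<close>
    let ?X = "{X. X \<subseteq> S \<and> (\<exists>Q\<in>p. Q \<inter> P \<subseteq> X)}"
    have "X \<inter> Y \<in> ?X" if XY: "X \<in> ?X" "Y \<in> ?X" for X Y
    proof -
      obtain Q R where "Q \<in> p" "R \<in> p" "Q \<inter> P \<subseteq> X" "R \<inter> P \<subseteq> Y" using XY by blast
      then have "Q \<inter> R \<in> p" "(Q \<inter> R) \<inter> P \<subseteq> X \<inter> Y" using int by auto
      then show ?thesis using XY by blast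
    qed
    moreover have "large X" if "X \<in> ?X" for X using that P mono by blast
    ultimately have "?X \<in> fam" using pS unfolding fam_def by blast
    moreover have "p \<subseteq> ?X" using pS by blast
    ultimately have "?X = p" by (rule max)
    moreover have "P \<in> ?X" using \<open>P \<subseteq> S\<close> pS by blast
    ultimately show ?thesis by simp
  qed
  have "Q \<in> p" if "P \<in> p" "P \<subseteq> Q" "Q \<subseteq> S" for P Q
  proof (rule memI[OF \<open>Q \<subseteq> S\<close>])
    fix R assume "R \<in> p"
    then have "large (R \<inter> P)" using int large that by blast
    then show "large (R \<inter> Q)" using that(2,3) by (elim mono) auto
  qed
  moreover have "P \<in> p \<or> S - P \<in> p" if PS: "P \<subseteq> S" for P
  proof (rule ccontr)
    assume "\<not> (P \<in> p \<or> S - P \<in> p)"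
    then obtain Q R where QR: "Q \<in> p" "R \<in> p" "\<not> large (Q \<inter> P)" "\<not> large (R \<inter> (S - P))"
      using memI[of P] memI[of "S - P"] PS by blast
    have sub: "Q \<subseteq> S" "R \<subseteq> S" using QR pS by auto
    have "large (Q \<inter> R)" using QR int large by blast
    moreover have "Q \<inter> R = (Q \<inter> R \<inter> P) \<union> (Q \<inter> R \<inter> (S - P))" using sub by blast
    ultimately have "large (Q \<inter> R \<inter> P) \<or> large (Q \<inter> R \<inter> (S - P))"
      using regular[of "Q \<inter> R \<inter> P" "Q \<inter> R \<inter> (S - P)"] sub by auto
    then show False
      using QR sub mono[of "Q \<inter> R \<inter> P" "Q \<inter> P"] mono[of "Q \<inter> R \<inter> (S - P)" "R \<inter> (S - P)"]
      by blast
  qed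
  moreover have "{} \<notin> p" using large not_empty by blast
  ultimately have "ultrafilter_on S p"
    using pS int by (simp add: ultrafilter_on_def)
  then show ?thesis using large by blast
qed

text \<open>A union of two sets may be good with neither part good, so \<open>good\<close> is
  strengthened to \<open>large\<close>: every finite coloring of the set has a good class. This
  notion passes to a part, because bad colorings of two sets merge into a bad coloring of their
  union.\<close>

lemma ultrafilter_on_of_colorings:
  fixes S :: "'a set"
  assumes mono: "\<And>P Q. good P \<Longrightarrow> P \<subseteq> Q \<Longrightarrow> Q \<subseteq> S \<Longrightarrow> good Q"
    and color: "\<And>f :: 'a \<Rightarrow> nat. finite (f ` S) \<Longrightarrow> \<exists>c\<in>f ` S. good {s \<in> S. f s = c}"
  shows "\<exists>p. ultrafilter_on S p \<and> (\<forall>P\<in>p. good P)"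
proof -
  define large where
    "large P \<longleftrightarrow> (\<forall>f :: 'a \<Rightarrow> nat. finite (f ` P) \<longrightarrow> (\<exists>c\<in>f ` P. good {s \<in> P. f s = c}))" for P
  have "\<exists>p. ultrafilter_on S p \<and> (\<forall>P\<in>p. large P)"
  proof (rule ultrafilter_on_of_partition_regular)
    show "large S" using color by (simp add: large_def)
    show "\<not> large {}" by (simp add: large_def)
  next
    fix P Q assume PQ: "large P" "P \<subseteq> Q" "Q \<subseteq> S"
    show "large Q" unfolding large_def
    proof (intro allI impI)
      fix f :: "'a \<Rightarrow> nat" assume "finite (f ` Q)"
      then have "finite (f ` P)" using PQ by (meson finite_subset image_mono)
      then obtain c where "c \<in> f ` P" "good {s \<in> P. f s = c}" using PQ large_def by blast
      then show "\<exists>c\<in>f ` Q. good {s \<in> Q. f s = c}"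
        using PQ mono[of "{s \<in> P. f s = c}" "{s \<in> Q. f s = c}"] by blast
    qed
  next
    fix P Q assume sub: "P \<subseteq> S" "Q \<subseteq> S" and un: "large (P \<union> Q)"
    show "large P \<or> large Q"
    proof (rule ccontr)
      assume neg: "\<not> (large P \<or> large Q)"
      then have "\<not> large P" by simp
      then obtain f :: "'a \<Rightarrow> nat"
        where f: "finite (f ` P)" "\<not> (\<exists>c\<in>f ` P. good {s \<in> P. f s = c})"
        unfolding large_def not_all not_imp by (elim exE conjE)
      from neg have "\<not> large Q" by simp
      then obtain g :: "'a \<Rightarrow> nat"
        where g: "finite (g ` Q)" "\<not> (\<exists>c\<in>g ` Q. good {s \<in> Q. g s = c})"
        unfolding large_def not_all not_imp by (elim exE conjE)
      \<comment> \<open>Even colors on \<open>P\<close> and odd ones on \<open>Q - P\<close> keep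
        the two colorings apart, so each class of \<open>h\<close> lies in a single class of
        \<open>f\<close> or of \<open>g\<close>.\<close>
      define h where "h s = (if s \<in> P then 2 * f s else 2 * g s + 1)" for s
      have "h ` (P \<union> Q) \<subseteq> (\<lambda>n. 2 * n) ` f ` P \<union> (\<lambda>n. 2 * n + 1) ` g ` Q"
        by (auto simp: h_def)
      then have "finite (h ` (P \<union> Q))"
        using f(1) g(1) by (meson finite_UnI finite_imageI finite_subset)
      then have "\<exists>c\<in>h ` (P \<union> Q). good {s \<in> P \<union> Q. h s = c}"
        using un unfolding large_def by (elim allE[of _ h]) simp
      then obtain t where t: "t \<in> P \<union> Q" and good: "good {s \<in> P \<union> Q. h s = h t}" by blast
      show False
      proof (cases "t \<in> P")
        case True
        have "{s \<in> P \<union> Q. h s = h t} \<subseteq> {s \<in> P. f s = f t}"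
          using True by (auto simp: h_def split: if_splits) presburger+
        from mono[OF good this] have "good {s \<in> P. f s = f t}" using sub by auto
        then show False using f(2) True by blast
      next
        case False
        have "{s \<in> P \<union> Q. h s = h t} \<subseteq> {s \<in> Q. g s = g t}"
          using False by (auto simp: h_def split: if_splits) presburger+
        from mono[OF good this] have "good {s \<in> Q. g s = g t}" using sub by auto
        then show False using g(2) t False by blast
      qed
    qed
  qed
  moreover have "good P" if "large P" for P
  proof -
    \<comment> \<open>For a constant coloring the only class is \<open>P\<close> itself.\<close>
    have "finite ((\<lambda>_. 0 :: nat) ` P)" by (rule finite_subset[of _ "{0}"]) auto
    then have "\<exists>c\<in>(\<lambda>_. 0 :: nat) ` P. good {s \<in> P. 0 = c}"
      using that unfolding large_def by (elim allE[of _ "\<lambda>_. 0"]) simp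
    then show ?thesis by auto
  qed
  ultimately show ?thesis by blast
qed

lemma ultrafilter_on_nonempty: "ultrafilter_on S p \<Longrightarrow> P \<in> p \<Longrightarrow> P \<noteq> {}"
  by (auto simp: ultrafilter_on_def)

text \<open>The factor \<open>S\<close> gives the intersection the right value for empty
  \<open>I\<close>, where it would otherwise be the whole type.\<close>

lemma ultrafilter_on_Inter:
  assumes "ultrafilter_on S p" "finite I" "\<And>i. i \<in> I \<Longrightarrow> P i \<in> p"
  shows "S \<inter> (\<Inter>i\<in>I. P i) \<in> p"
  using assms(2,3)
proof (induction I)
  case empty
  then show ?case using assms(1) by (simp add: ultrafilter_on_def)
next
  case (insert i I)
  then have "P i \<inter> (S \<inter> (\<Inter>i\<in>I. P i)) \<in> p" using assms(1) by (simp add: ultrafilter_on_def)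
  then show ?case by (simp add: Int_ac)
qed

lemma ultrafilter_on_color_class:
  assumes p: "ultrafilter_on S p" and "finite (f ` S)"
  shows "\<exists>c\<in>f ` S. {s \<in> S. f s = c} \<in> p"
proof (rule ccontr)
  assume neg: "\<not> ?thesis"
  have "S - {s \<in> S. f s = c} \<in> p" if "c \<in> f ` S" for c
    using neg p that unfolding ultrafilter_on_def by (metis (no_types, lifting) mem_Collect_eq subsetI)
  then have "S \<inter> (\<Inter>c\<in>f ` S. S - {s \<in> S. f s = c}) \<in> p"
    by (rule ultrafilter_on_Inter[OF p assms(2)])
  moreover have "S \<inter> (\<Inter>c\<in>f ` S. S - {s \<in> S. f s = c}) = {}" by auto
  ultimately show False using p by (simp add: ultrafilter_on_def)
qed

section \<open>Images of matrices and multiplication by positive integers\<close>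

text \<open>The condition that \<open>I_set\<close> imposes on each member, isolated so that it can
  serve as \<open>good\<close>.\<close>

definition has_image :: "('r, 'c) ord_matrix \<Rightarrow> real set \<Rightarrow> real set \<Rightarrow> bool" where
  "has_image A S P \<longleftrightarrow> (\<exists>x \<in> col_index A \<rightarrow> S. \<forall>i\<in>row_index A. mat_app A x i \<in> P)"

lemma has_image_mono: "has_image A S P \<Longrightarrow> P \<subseteq> Q \<Longrightarrow> has_image A S Q"
  unfolding has_image_def by blast

lemma I_set_iff: "p \<in> I_set A S \<longleftrightarrow> ultrafilter_on S p \<and> (\<forall>P\<in>p. has_image A S P)"
  by (simp add: I_set_def beta_def has_image_def)

lemma mat_app_scale: "mat_app A (\<lambda>j. s * x j) i = s * mat_app A x i"
  by (simp add: mat_app_def sum_distrib_left mult.left_commute)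

lemma pos_nats_mult_closed:
  assumes add: "\<forall>x\<in>S. \<forall>y\<in>S. x + y \<in> S" and "n \<in> pos_nats" "s \<in> S"
  shows "n * s \<in> S"
proof -
  \<comment> \<open>The induction starts at one copy of \<open>s\<close>, since \<open>0 * s\<close>
    need not lie in \<open>S\<close>.\<close>
  have "of_nat (Suc m) * s \<in> S" for m
  proof (induction m)
    case (Suc m)
    then show ?case using bspec[OF bspec[OF add \<open>s \<in> S\<close>] Suc.IH] by (simp add: algebra_simps)
  qed (use \<open>s \<in> S\<close> in simp)
  moreover obtain k where "n = of_nat k" "k \<noteq> 0"
    using \<open>n \<in> pos_nats\<close> by (auto simp: pos_nats_def elim: Nats_cases)
  then obtain m where "n = of_nat (Suc m)" using not0_implies_Suc by blast
  ultimately show ?thesis by simp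
qed

lemma has_image_scale:
  assumes add: "\<forall>x\<in>S. \<forall>y\<in>S. x + y \<in> S" and n: "n \<in> pos_nats"
    and "has_image A S {s \<in> S. n * s \<in> P}"
  shows "has_image A S P"
proof -
  obtain x where x: "x \<in> col_index A \<rightarrow> S" "\<forall>i\<in>row_index A. n * mat_app A x i \<in> P"
    using assms(3) by (auto simp: has_image_def)
  have "(\<lambda>j. n * x j) \<in> col_index A \<rightarrow> S" using x(1) pos_nats_mult_closed[OF add n] by blast
  then show ?thesis
    unfolding has_image_def using x(2) by (intro bexI[of _ "\<lambda>j. n * x j"]) (simp_all add: mat_app_scale)
qed

text \<open>The first conjunct handles \<open>A\<close>. The second, through
  \<open>has_image_scale\<close>, carries over to the same class every matrix that has images in all
  members of \<open>q\<close>.\<close>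

lemma ipr_color_class:
  fixes f :: "real \<Rightarrow> nat"
  assumes add: "\<forall>x\<in>S. \<forall>y\<in>S. x + y \<in> S"
    and fin: "finite_matrix A" and ipr: "image_partition_regular A"
    and q: "ultrafilter_on S q" and f: "finite (f ` S)"
  shows "\<exists>c. has_image A S {s \<in> S. f s = c} \<and>
             (\<exists>n\<in>pos_nats. {s \<in> S. n * s \<in> {t \<in> S. f t = c}} \<in> q)"
proof -
  have closed: "n * s \<in> S" if "n \<in> pos_nats" "s \<in> S" for n s
    using pos_nats_mult_closed[OF add] that by blast
  have "\<exists>c\<in>f ` S. {s \<in> S. f (n * s) = c} \<in> q" if "n \<in> pos_nats" for n
  proof -
    have sub: "(\<lambda>s. f (n * s)) ` S \<subseteq> f ` S" using closed that by blast
    then have "finite ((\<lambda>s. f (n * s)) ` S)" using f finite_subset by blast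
    then show ?thesis using ultrafilter_on_color_class[OF q] sub by blast
  qed
  \<comment> \<open>\<open>g n\<close> is the color that \<open>f\<close> gives to
    \<open>n * s\<close> for \<open>q\<close>-almost all \<open>s\<close>.\<close>
  then obtain g where g: "\<And>n. n \<in> pos_nats \<Longrightarrow> g n \<in> f ` S"
    "\<And>n. n \<in> pos_nats \<Longrightarrow> {s \<in> S. f (n * s) = g n} \<in> q" by metis
  have "finite_coloring pos_nats g"
    unfolding finite_coloring_def using f g(1) by (meson finite_subset image_subsetI)
  then obtain x c where x: "x \<in> col_index A \<rightarrow> pos_nats"
    and c: "\<And>i. i \<in> row_index A \<Longrightarrow> mat_app A x i \<in> pos_nats \<and> g (mat_app A x i) = c"
    using ipr unfolding image_partition_regular_def by blast
  have mem: "{s \<in> S. f (mat_app A x i * s) = c} \<in> q" if "i \<in> row_index A" for i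
    using c[OF that] g(2) by auto
  have rows: "finite (row_index A)" "row_index A \<noteq> {}"
    using fin by (auto simp: finite_matrix_def Field_natLeq_on)
  \<comment> \<open>As there are finitely many rows, one \<open>s\<close> serves all of them at
    once.\<close>
  have "S \<inter> (\<Inter>i\<in>row_index A. {s \<in> S. f (mat_app A x i * s) = c}) \<in> q"
    using ultrafilter_on_Inter[OF q rows(1) mem] .
  then have "S \<inter> (\<Inter>i\<in>row_index A. {s \<in> S. f (mat_app A x i * s) = c}) \<noteq> {}"
    by (rule ultrafilter_on_nonempty[OF q])
  then obtain s where s: "s \<in> S" "\<And>i. i \<in> row_index A \<Longrightarrow> f (mat_app A x i * s) = c"
    by blast
  have "(\<lambda>j. s * x j) \<in> col_index A \<rightarrow> S"
    using x s(1) closed by (auto simp: mult.commute[of s])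
  moreover have "mat_app A (\<lambda>j. s * x j) i \<in> {s \<in> S. f s = c}" if "i \<in> row_index A" for i
  proof -
    have "mat_app A (\<lambda>j. s * x j) i = mat_app A x i * s"
      by (subst mat_app_scale) (rule mult.commute)
    then show ?thesis using s c[OF that] that closed by simp
  qed
  ultimately have "has_image A S {s \<in> S. f s = c}"
    unfolding has_image_def by blast
  \<comment> \<open>Any entry of \<open>A x\<close> can be the multiplier \<open>n\<close>; a finite
    matrix has at least one row.\<close>
  moreover obtain i where i: "i \<in> row_index A" using rows(2) by blast
  have "{s \<in> S. mat_app A x i * s \<in> {t \<in> S. f t = c}} = {s \<in> S. f (mat_app A x i * s) = c}"
    using closed c[OF i] by auto
  then have "\<exists>n\<in>pos_nats. {s \<in> S. n * s \<in> {t \<in> S. f t = c}} \<in> q"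
    using mem[OF i] c[OF i] by (intro bexI[of _ "mat_app A x i"]) simp_all
  ultimately show ?thesis by blast
qed

section \<open>Common ultrafilters for \<open>B\<close> and finitely many finite matrices\<close>

lemma I_set_near_zero_nonempty:
  assumes "S \<noteq> {}" and B: "image_partition_regular_near_zero S B"
  shows "I_set B S \<noteq> {}"
proof -
  have "\<exists>p. ultrafilter_on S p \<and> (\<forall>P\<in>p. has_image B S P)"
  proof (rule ultrafilter_on_of_colorings[where good = "has_image B S"])
    fix f :: "real \<Rightarrow> nat" assume "finite (f ` S)"
    then have "\<exists>x \<in> col_index B \<rightarrow> S. \<exists>c. \<forall>i\<in>row_index B.
        mat_app B x i \<in> S \<and> f (mat_app B x i) = c \<and> mat_app B x i \<in> {-1<..<1}"
      \<comment> \<open>The value 1 is an arbitrary choice of \<epsilon>.\<close>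
      using conjunct2[OF B[unfolded image_partition_regular_near_zero_def], rule_format, of f 1]
      by (simp add: finite_coloring_def)
    then obtain x c where x: "x \<in> col_index B \<rightarrow> S"
      and c: "\<And>i. i \<in> row_index B \<Longrightarrow> mat_app B x i \<in> S \<and> f (mat_app B x i) = c" by blast
    show "\<exists>c\<in>f ` S. has_image B S {s \<in> S. f s = c}"
    \<comment> \<open>Without rows, \<open>c\<close> need not be a color of \<open>f\<close>, but
      then every class vacuously contains an image.\<close>
    proof (cases "row_index B = {}")
      case True
      then show ?thesis using x \<open>S \<noteq> {}\<close> unfolding has_image_def by blast
    next
      case False
      then have "c \<in> f ` S" using c by blast
      then show ?thesis using x c unfolding has_image_def by blast
    qed
  qed (rule has_image_mono)
  then obtain p where "p \<in> I_set B S" by (auto simp only: I_set_iff)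
  then show ?thesis by blast
qed

text \<open>The induction step changes the ultrafilter: \<open>q\<close> need not lie in
  \<open>I_set A S\<close>, but it selects in each finite coloring a class good for
  \<open>A\<close>, \<open>B\<close> and all of \<open>F\<close>, and these classes produce a new
  ultrafilter.\<close>

lemma I_set_finite_Inter_nonempty:
  fixes F :: "(nat, nat) ord_matrix set"
  assumes add: "\<forall>x\<in>S. \<forall>y\<in>S. x + y \<in> S"
    and "finite F" and "\<And>A. A \<in> F \<Longrightarrow> finite_matrix A \<and> image_partition_regular A"
    and B: "I_set B S \<noteq> {}"
  shows "I_set B S \<inter> (\<Inter>A\<in>F. I_set A S) \<noteq> {}"
  using assms(2,3)
proof (induction F)
  case empty
  then show ?case using B by simp
next
  case (insert A F)
  then obtain q where q: "q \<in> I_set B S" "\<And>A. A \<in> F \<Longrightarrow> q \<in> I_set A S" by auto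
  then have uq: "ultrafilter_on S q" by (simp add: I_set_iff)
  have A: "finite_matrix A \<and> image_partition_regular A" using insert.prems by simp
  let ?good = "\<lambda>P. has_image B S P \<and> (\<forall>A\<in>insert A F. has_image A S P)"
  have "\<exists>p. ultrafilter_on S p \<and> (\<forall>P\<in>p. ?good P)"
  proof (rule ultrafilter_on_of_colorings[where good = ?good])
    fix f :: "real \<Rightarrow> nat" assume f: "finite (f ` S)"
    obtain c n where c: "has_image A S {s \<in> S. f s = c}" and n: "n \<in> pos_nats"
      and mem: "{s \<in> S. n * s \<in> {t \<in> S. f t = c}} \<in> q"
      using ipr_color_class[OF add conjunct1[OF A] conjunct2[OF A] uq f] by blast
    have "has_image B S {s \<in> S. n * s \<in> {t \<in> S. f t = c}}"
      using q(1) mem by (simp only: I_set_iff)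
    then have "has_image B S {s \<in> S. f s = c}" by (rule has_image_scale[OF add n])
    moreover have "has_image A' S {s \<in> S. f s = c}" if "A' \<in> F" for A'
    proof -
      have "has_image A' S {s \<in> S. n * s \<in> {t \<in> S. f t = c}}"
        using q(2)[OF that] mem by (simp only: I_set_iff)
      then show ?thesis by (rule has_image_scale[OF add n])
    qed
    moreover have "c \<in> f ` S"
    proof -
      have "{s \<in> S. n * s \<in> {t \<in> S. f t = c}} \<noteq> {}"
        using uq mem by (rule ultrafilter_on_nonempty)
      then show ?thesis by blast
    qed
    ultimately show "\<exists>c\<in>f ` S. ?good {s \<in> S. f s = c}" using c by blast
  next
    fix P Q assume "?good P" "P \<subseteq> Q"
    then show "?good Q" by (simp add: has_image_mono[OF _ \<open>P \<subseteq> Q\<close>])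
  qed
  then obtain p where "p \<in> I_set B S" "\<forall>A\<in>insert A F. p \<in> I_set A S"
    unfolding I_set_iff by blast
  then show ?case by blast
qed

section \<open>From finitely many matrices to the whole class\<close>

theorem theorem2p17:
  fixes S :: "real set"
    and F :: "(nat, nat) ord_matrix set"
    and B :: "('r, 'c) ord_matrix"
  assumes "dense_subsemigroup S"
    and "\<And>A. A \<in> F \<Longrightarrow> finite_matrix A \<and> image_partition_regular A"
    and "image_partition_regular_near_zero S B"
  shows "I_set B S \<inter> (\<Inter>A\<in>F. I_set A S) \<noteq> {}"
proof -
  have add: "\<forall>x\<in>S. \<forall>y\<in>S. x + y \<in> S"
    using assms(1) by (simp add: dense_subsemigroup_def)
  have "S \<noteq> {}"
    using assms(1) by (force simp: dense_subsemigroup_def)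
  then have B: "I_set B S \<noteq> {}" using assms(3) by (rule I_set_near_zero_nonempty)
  let ?good = "\<lambda>P. has_image B S P \<and> (\<forall>A\<in>F. has_image A S P)"
  have "\<exists>p. ultrafilter_on S p \<and> (\<forall>P\<in>p. ?good P)"
  proof (rule ultrafilter_on_of_colorings[where good = ?good])
    fix f :: "real \<Rightarrow> nat" assume f: "finite (f ` S)"
    show "\<exists>c\<in>f ` S. ?good {s \<in> S. f s = c}"
    proof (rule ccontr)
      assume "\<not> ?thesis"
      \<comment> \<open>Only finitely many matrices of \<open>F\<close> are needed to witness that each color class fails.\<close>
      then have "\<forall>c\<in>f ` S. \<exists>A. has_image B S {s \<in> S. f s = c} \<longrightarrow>
          A \<in> F \<and> \<not> has_image A S {s \<in> S. f s = c}" by blast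
      from bchoice[OF this] obtain A where A: "\<forall>c\<in>f ` S. has_image B S {s \<in> S. f s = c} \<longrightarrow>
          A c \<in> F \<and> \<not> has_image (A c) S {s \<in> S. f s = c}" ..
      \<comment> \<open>Where \<open>B\<close> has no image in the class of \<open>c\<close>, the
        matrix \<open>A c\<close> is arbitrary and may lie outside \<open>F\<close>; hence the
        intersection with \<open>F\<close>.\<close>
      have "I_set B S \<inter> (\<Inter>M\<in>A ` f ` S \<inter> F. I_set M S) \<noteq> {}"
        by (rule I_set_finite_Inter_nonempty[OF add _ _ B]) (use f assms(2) in auto)
      then obtain p where "p \<in> I_set B S \<inter> (\<Inter>M\<in>A ` f ` S \<inter> F. I_set M S)"
        by (meson ex_in_conv)
      then have p: "p \<in> I_set B S" "\<And>M. M \<in> A ` f ` S \<inter> F \<Longrightarrow> p \<in> I_set M S"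
        by (rule IntD1, rule INT_D[OF IntD2])
      from p(1) have "ultrafilter_on S p" by (simp add: I_set_iff)
      \<comment> \<open>The class belonging to \<open>p\<close> contains an image of
        \<open>B\<close>, so \<open>A c\<close> is a true witness of failure; but \<open>p\<close>
        also lies in \<open>I_set (A c) S\<close>.\<close>
      then obtain c where c: "c \<in> f ` S" "{s \<in> S. f s = c} \<in> p"
        using ultrafilter_on_color_class f by blast
      have "has_image B S {s \<in> S. f s = c}" using p(1) c(2) unfolding I_set_iff by blast
      with bspec[OF A c(1)] have "A c \<in> F" "\<not> has_image (A c) S {s \<in> S. f s = c}" by simp_all
      moreover have "p \<in> I_set (A c) S" using \<open>A c \<in> F\<close> c(1) by (intro p(2)) auto
      ultimately show False using c(2) unfolding I_set_iff by blast
    qed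
  next
    fix P Q assume "?good P" "P \<subseteq> Q"
    then show "?good Q" by (simp add: has_image_mono[OF _ \<open>P \<subseteq> Q\<close>])
  qed
  then obtain p where "p \<in> I_set B S" "\<forall>A\<in>F. p \<in> I_set A S" unfolding I_set_iff by blast
  then show ?thesis by blast
qed

end
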